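(* Let $\Sigma\subset\mathbb{R}^3=\mathrm{Im}\,\mathbb{H}$ be an oriented surface with induced metric $g_\Sigma$ and unit normal $\nu:\Sigma\to\mathbb{R}^3$ such that $(e_1,e_2,\nu_x)$ is positively oriented in $\mathbb{R}^3$ whenever $(e_1,e_2)$ is an oriented orthonormal frame of $T_x\Sigma$. Let $v\in T_x\Sigma\subset\mathrm{Im}\,\mathbb{H}$ act on $\mathbb{H}$ by left quaternionic multiplication. Then this makes the trivial bundle $\underline{\mathbb{H}}\to\Sigma$, with metric $\mathrm{Re}(\overline{q}w)$, a bundle of irreducible $C\ell(T\Sigma,g_\Sigma)$-modules commuting with right multiplication by $\mathbb{H}$. Moreover $k_La_R+b_R\mapsto(\nu_x)_La_R+b_R$ defines a right action of $M_2(\mathbb{C})$ on $\underline{\mathbb{H}}_x$ commuting with $C\ell^0(T_x\Sigma)$. Let $x\in\Sigma$ and let $(e_1,e_2)$ be an oriented orthonormal frame of $T_x\Sigma$. Let $R\in SO(3)$ be the rotation with $R(i)=e_1$, $R(j)=e_2$, $R(k)=\nu_x$, and let $g\in\mathbb{S}^3$ be a unit quaternion with $g\,q\,g^{-1}=R(q)$ for all $q\in\mathrm{Im}\,\mathbb{H}$. Then $\Phi_g:\mathbb{H}\to\underline{\mathbb{H}}_x$, $\Phi_g(q)=g\cdot q$, is a spin coordinate system covering $(e_1,e_2)$: it is an isometry, it satisfies $$\Phi_g\bigl((ai+bj)q\bigr)=(ae_1+be_2)\,\Phi_g(q)\quad(a,b\in\mathbb{R},\ q\in\mathbb{H}),$$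 and $$\Phi_g\bigl((k_La_R+b_R)q\bigr)=\bigl((\nu_x)_La_R+b_R\bigr)\Phi_g(q)\quad(a,b,q\in\mathbb{H}).$$ The only other spin coordinate system covering $(e_1,e_2)$ is $\Phi_{-g}$.
   Context: $C\ell(T\Sigma,g_\Sigma)$ is the bundle of real Clifford algebras with relations $v\cdot w+w\cdot v=-2g_\Sigma(v,w)$, and $C\ell^0$ is its even part. For $p\in\mathbb{H}$, $p_L$ and $p_R$ denote left and right multiplication by $p$ on $\mathbb{H}$. The reference spinor module for $\mathbb{R}^2$ is $\mathbb{H}$ with metric $\mathrm{Re}(\overline{q}w)$ and Clifford action $c(a,b)=(ai+bj)_L$. The algebra of real-linear endomorphisms of $\mathbb{H}$ commuting with $C\ell_2^0=\mathrm{Span}\{1,k_L\}$ consists of the operators $k_La_R+b_R$ with $a,b\in\mathbb{H}$, and is isomorphic to $M_2(\mathbb{C})$. A spin coordinate system at $x$ covering $(e_1,e_2)$ is a linear isometry $\Phi:\mathbb{H}\to\underline{\mathbb{H}}_x$ that intertwines the right $M_2(\mathbb{C})$-actions (the operator $k_La_R+b_R$ on the source corresponding to $(\nu_x)_La_R+b_R$ on the target) and satisfies $\Phi((ai+bj)q)=(ae_1+be_2)\Phi(q)$ for all $a,b\in\mathbb{R}$, $q\in\mathbb{H}$. *)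

theory Defs
  imports "HOL-Analysis.Analysis" "HOL-Library.Poly_Mapping"
begin

section \<open>Quaternions\<close>

datatype quat = Quat (quat_re: real) (quat_i: real) (quat_j: real) (quat_k: real)

lemma quat_eq_iff:
  "p = q \<longleftrightarrow> quat_re p = quat_re q \<and> quat_i p = quat_i q \<and> quat_j p = quat_j q \<and> quat_k p = quat_k q"
  by (cases p; cases q) simp

definition quat_cnj :: "quat \<Rightarrow> quat" where
  "quat_cnj q = Quat (quat_re q) (- quat_i q) (- quat_j q) (- quat_k q)"

lemma quat_cnj_sel [simp]:
  "quat_re (quat_cnj q) = quat_re q" "quat_i (quat_cnj q) = - quat_i q"
  "quat_j (quat_cnj q) = - quat_j q" "quat_k (quat_cnj q) = - quat_k q"
  by (simp_all add: quat_cnj_def)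

instantiation quat :: real_algebra_1
begin

definition "0 = Quat 0 0 0 0"
definition "1 = Quat 1 0 0 0"
definition "- q = Quat (- quat_re q) (- quat_i q) (- quat_j q) (- quat_k q)"
definition "p + q = Quat (quat_re p + quat_re q) (quat_i p + quat_i q) (quat_j p + quat_j q) (quat_k p + quat_k q)"
definition "p - q = Quat (quat_re p - quat_re q) (quat_i p - quat_i q) (quat_j p - quat_j q) (quat_k p - quat_k q)"
definition "r *\<^sub>R q = Quat (r * quat_re q) (r * quat_i q) (r * quat_j q) (r * quat_k q)"
definition "p * q = Quat
  (quat_re p * quat_re q - quat_i p * quat_i q - quat_j p * quat_j q - quat_k p * quat_k q)
  (quat_re p * quat_i q + quat_i p * quat_re q + quat_j p * quat_k q - quat_k p * quat_j q)
  (quat_re p * quat_j q - quat_i p * quat_k q + quat_j p * quat_re q + quat_k p * quat_i q)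
  (quat_re p * quat_k q + quat_i p * quat_j q - quat_j p * quat_i q + quat_k p * quat_re q)"

instance
  by standard
    (simp_all add: zero_quat_def one_quat_def uminus_quat_def plus_quat_def minus_quat_def
      scaleR_quat_def times_quat_def algebra_simps)

end

lemma quat_sel [simp]:
  "quat_re 0 = 0" "quat_i 0 = 0" "quat_j 0 = 0" "quat_k 0 = 0"
  "quat_re 1 = 1" "quat_i 1 = 0" "quat_j 1 = 0" "quat_k 1 = 0"
  "quat_re (- p) = - quat_re p" "quat_i (- p) = - quat_i p"
  "quat_j (- p) = - quat_j p" "quat_k (- p) = - quat_k p"
  "quat_re (p + q) = quat_re p + quat_re q" "quat_i (p + q) = quat_i p + quat_i q"
  "quat_j (p + q) = quat_j p + quat_j q" "quat_k (p + q) = quat_k p + quat_k q"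
  "quat_re (p - q) = quat_re p - quat_re q" "quat_i (p - q) = quat_i p - quat_i q"
  "quat_j (p - q) = quat_j p - quat_j q" "quat_k (p - q) = quat_k p - quat_k q"
  "quat_re (r *\<^sub>R q) = r * quat_re q" "quat_i (r *\<^sub>R q) = r * quat_i q"
  "quat_j (r *\<^sub>R q) = r * quat_j q" "quat_k (r *\<^sub>R q) = r * quat_k q"
  by (simp_all add: zero_quat_def one_quat_def uminus_quat_def plus_quat_def minus_quat_def
      scaleR_quat_def)

lemma quat_mult_sel:
  "quat_re (p * q) = quat_re p * quat_re q - quat_i p * quat_i q - quat_j p * quat_j q - quat_k p * quat_k q"
  "quat_i (p * q) = quat_re p * quat_i q + quat_i p * quat_re q + quat_j p * quat_k q - quat_k p * quat_j q"
  "quat_j (p * q) = quat_re p * quat_j q - quat_i p * quat_k q + quat_j p * quat_re q + quat_k p * quat_i q"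
  "quat_k (p * q) = quat_re p * quat_k q + quat_i p * quat_j q - quat_j p * quat_i q + quat_k p * quat_re q"
  by (simp_all add: times_quat_def)

instantiation quat :: real_inner
begin

definition inner_quat :: "quat \<Rightarrow> quat \<Rightarrow> real" where
  "inner_quat q w = quat_re (quat_cnj q * w)"
definition norm_quat :: "quat \<Rightarrow> real" where "norm_quat q = sqrt (inner q q)"
definition sgn_quat :: "quat \<Rightarrow> quat" where "sgn_quat q = q /\<^sub>R norm q"
definition dist_quat :: "quat \<Rightarrow> quat \<Rightarrow> real" where "dist_quat p q = norm (p - q)"
definition uniformity_quat :: "(quat \<times> quat) filter" where
  "uniformity_quat = (INF e\<in>{0<..}. principal {(x, y). dist x y < e})"
definition open_quat :: "quat set \<Rightarrow> bool" where
  "open_quat U \<longleftrightarrow> (\<forall>x\<in>U. eventually (\<lambda>(x', y). x' = x \<longrightarrow> y \<in> U) uniformity)"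

instance
proof
  fix p q w :: quat and r :: real and U :: "quat set"
  show "inner p q = inner q p" "inner (p + q) w = inner p w + inner q w"
    "inner (r *\<^sub>R p) q = r * inner p q"
    by (simp_all add: inner_quat_def quat_mult_sel algebra_simps)
  have *: "inner p p = (quat_re p)\<^sup>2 + (quat_i p)\<^sup>2 + (quat_j p)\<^sup>2 + (quat_k p)\<^sup>2"
    by (simp add: inner_quat_def quat_mult_sel power2_eq_square)
  show "0 \<le> inner p p" by (simp add: *)
  show "inner p p = 0 \<longleftrightarrow> p = 0"
    by (auto simp: * quat_eq_iff add_nonneg_eq_0_iff)
qed (simp_all add: norm_quat_def sgn_quat_def dist_quat_def uniformity_quat_def open_quat_def)

end

lemma quat_inner_sel:
  "inner p q = quat_re p * quat_re q + quat_i p * quat_i q + quat_j p * quat_j q + quat_k p * quat_k q"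
  by (simp add: inner_quat_def quat_mult_sel)

lemma quat_norm_sq:
  "(norm q)\<^sup>2 = (quat_re q)\<^sup>2 + (quat_i q)\<^sup>2 + (quat_j q)\<^sup>2 + (quat_k q)\<^sup>2"
  unfolding power2_norm_eq_inner quat_inner_sel by (simp add: power2_eq_square)

lemma quat_cnj_mult: "quat_cnj q * q = (norm q)\<^sup>2 *\<^sub>R 1" "q * quat_cnj q = (norm q)\<^sup>2 *\<^sub>R 1"
  unfolding quat_norm_sq by (simp_all add: quat_eq_iff quat_mult_sel power2_eq_square)

instantiation quat :: real_normed_div_algebra
begin

definition inverse_quat :: "quat \<Rightarrow> quat" where "inverse_quat q = quat_cnj q /\<^sub>R (norm q)\<^sup>2"
definition divide_quat :: "quat \<Rightarrow> quat \<Rightarrow> quat" where "divide_quat p q = p * inverse q"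

instance
proof
  fix p q :: quat
  show "p \<noteq> 0 \<Longrightarrow> inverse p * p = 1" "p \<noteq> 0 \<Longrightarrow> p * inverse p = 1"
    by (simp_all add: inverse_quat_def quat_cnj_mult)
  show "p div q = p * inverse q" by (simp add: divide_quat_def)
  show "inverse (0::quat) = 0" by (simp add: inverse_quat_def quat_cnj_def quat_eq_iff)
  have "(norm (p * q))\<^sup>2 = (norm p * norm q)\<^sup>2"
    unfolding power_mult_distrib quat_norm_sq quat_mult_sel by (simp add: power2_eq_square algebra_simps)
  then show "norm (p * q) = norm p * norm q"
    by (simp add: power2_eq_iff_nonneg)
qed

end

definition q\<i> :: quat where "q\<i> = Quat 0 1 0 0"
definition q\<j> :: quat where "q\<j> = Quat 0 0 1 0"
definition q\<k> :: quat where "q\<k> = Quat 0 0 0 1"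

text \<open>The identification \<open>\<real>\<^sup>3 = Im \<bbbH>\<close>.\<close>

definition im_quat :: "real^3 \<Rightarrow> quat" where
  "im_quat v = Quat 0 (v $ 1) (v $ 2) (v $ 3)"

text \<open>\<open>LR_op u a b\<close> is the operator \<open>u\<^sub>L a\<^sub>R + b\<^sub>R\<close>.\<close>

definition LR_op :: "quat \<Rightarrow> quat \<Rightarrow> quat \<Rightarrow> quat \<Rightarrow> quat" where
  "LR_op u a b = (\<lambda>q. u * q * a + q * b)"

section \<open>Clifford algebras\<close>

datatype 'v word = Word (letters: "'v list")

instantiation word :: (type) monoid_add
begin
definition "0 = Word []"
definition "v + w = Word (letters v @ letters w)"
instance by standard (simp_all add: zero_word_def plus_word_def)
end

text \<open>The free unital associative real algebra on a set \<open>V\<close>: finite real combinations of words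
  with letters in \<open>V\<close>, multiplied by concatenation.\<close>

type_synonym 'v free_algebra = "'v word \<Rightarrow>\<^sub>0 real"

definition free_algebra_on :: "'v set \<Rightarrow> 'v free_algebra set" where
  "free_algebra_on V = {p. \<forall>w\<in>Poly_Mapping.keys p. set (letters w) \<subseteq> V}"

definition fa_scalar :: "real \<Rightarrow> 'v free_algebra" where
  "fa_scalar r = Poly_Mapping.single 0 r"

definition fa_gen :: "'v \<Rightarrow> 'v free_algebra" where
  "fa_gen v = Poly_Mapping.single (Word [v]) 1"

text \<open>The two-sided ideal generated by the linear relations (which make \<open>V\<close> a linear subspace of the
  quotient) and the Clifford relations \<open>v \<cdot> w + w \<cdot> v = - 2 g(v,w)\<close>.\<close>

inductive_set clifford_ideal :: "'v::real_vector set \<Rightarrow> ('v \<Rightarrow> 'v \<Rightarrow> real) \<Rightarrow> 'v free_algebra set"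
  for V g where
  add_rel: "v \<in> V \<Longrightarrow> w \<in> V \<Longrightarrow> fa_gen (v + w) - (fa_gen v + fa_gen w) \<in> clifford_ideal V g"
| scale_rel: "v \<in> V \<Longrightarrow> fa_gen (r *\<^sub>R v) - fa_scalar r * fa_gen v \<in> clifford_ideal V g"
| clifford_rel: "v \<in> V \<Longrightarrow> w \<in> V \<Longrightarrow>
    fa_gen v * fa_gen w + fa_gen w * fa_gen v - fa_scalar (- 2 * g v w) \<in> clifford_ideal V g"
| zero: "0 \<in> clifford_ideal V g"
| add: "p \<in> clifford_ideal V g \<Longrightarrow> q \<in> clifford_ideal V g \<Longrightarrow> p + q \<in> clifford_ideal V g"
| mult: "p \<in> clifford_ideal V g \<Longrightarrow> a \<in> free_algebra_on V \<Longrightarrow> b \<in> free_algebra_on V \<Longrightarrow>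
    a * p * b \<in> clifford_ideal V g"

definition cl_class :: "'v::real_vector set \<Rightarrow> ('v \<Rightarrow> 'v \<Rightarrow> real) \<Rightarrow> 'v free_algebra \<Rightarrow> 'v free_algebra set" where
  "cl_class V g p = {q \<in> free_algebra_on V. q - p \<in> clifford_ideal V g}"

definition clifford_algebra :: "'v::real_vector set \<Rightarrow> ('v \<Rightarrow> 'v \<Rightarrow> real) \<Rightarrow> 'v free_algebra set set" where
  "clifford_algebra V g = cl_class V g ` free_algebra_on V"

definition clifford_even :: "'v::real_vector set \<Rightarrow> ('v \<Rightarrow> 'v \<Rightarrow> real) \<Rightarrow> 'v free_algebra set set" where
  "clifford_even V g = cl_class V g `
     {p \<in> free_algebra_on V. \<forall>w\<in>Poly_Mapping.keys p. even (length (letters w))}"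

text \<open>A module structure is a unital real algebra homomorphism \<open>\<rho>\<close> from the Clifford algebra to
  \<open>End\<^sub>\<real>(M)\<close>, where \<open>M\<close> is the whole type \<open>'m\<close>; \<open>\<rho>\<close> is constrained on the Clifford algebra only.\<close>

definition clifford_module ::
  "'v::real_vector set \<Rightarrow> ('v \<Rightarrow> 'v \<Rightarrow> real) \<Rightarrow> ('v free_algebra set \<Rightarrow> 'm::real_vector \<Rightarrow> 'm) \<Rightarrow> bool" where
  "clifford_module V g \<rho> \<longleftrightarrow>
     (\<forall>A\<in>clifford_algebra V g. linear (\<rho> A)) \<and>
     (\<forall>r. \<rho> (cl_class V g (fa_scalar r)) = (\<lambda>m. r *\<^sub>R m)) \<and>
     (\<forall>p\<in>free_algebra_on V. \<forall>q\<in>free_algebra_on V.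
        \<rho> (cl_class V g (p + q)) = (\<lambda>m. \<rho> (cl_class V g p) m + \<rho> (cl_class V g q) m) \<and>
        \<rho> (cl_class V g (p * q)) = \<rho> (cl_class V g p) \<circ> \<rho> (cl_class V g q))"

definition irreducible_clifford_module ::
  "'v::real_vector set \<Rightarrow> ('v \<Rightarrow> 'v \<Rightarrow> real) \<Rightarrow> ('v free_algebra set \<Rightarrow> 'm::real_vector \<Rightarrow> 'm) \<Rightarrow> bool" where
  "irreducible_clifford_module V g \<rho> \<longleftrightarrow>
     clifford_module V g \<rho> \<and> (\<exists>m::'m. m \<noteq> 0) \<and>
     (\<forall>S. subspace S \<and> (\<forall>A\<in>clifford_algebra V g. \<rho> A ` S \<subseteq> S) \<longrightarrow> S = {0} \<or> S = UNIV)"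

section \<open>Oriented surfaces in \<open>\<real>\<^sup>3\<close>\<close>

text \<open>Intended for open \<open>S\<close> in a finite-dimensional space, where continuity of all iterated
  directional derivatives is the usual notion of \<open>C\<^sup>k\<close>.\<close>

primrec Ck_on :: "nat \<Rightarrow> ('a::real_normed_vector \<Rightarrow> 'b::real_normed_vector) \<Rightarrow> 'a set \<Rightarrow> bool" where
  "Ck_on 0 f S \<longleftrightarrow> continuous_on S f"
| "Ck_on (Suc k) f S \<longleftrightarrow> (\<forall>x\<in>S. f differentiable (at x)) \<and>
     (\<forall>v. Ck_on k (\<lambda>x. frechet_derivative f (at x) v) S)"

definition smooth_on :: "('a::real_normed_vector \<Rightarrow> 'b::real_normed_vector) \<Rightarrow> 'a set \<Rightarrow> bool" where
  "smooth_on f S \<longleftrightarrow> (\<forall>k. Ck_on k f S)"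

definition local_parametrization ::
  "(real^3) set \<Rightarrow> (real \<times> real) set \<Rightarrow> (real \<times> real \<Rightarrow> real^3) \<Rightarrow> bool" where
  "local_parametrization \<Sigma> U \<phi> \<longleftrightarrow>
     open U \<and> smooth_on \<phi> U \<and> (\<forall>u\<in>U. inj (frechet_derivative \<phi> (at u))) \<and>
     openin (top_of_set \<Sigma>) (\<phi> ` U) \<and> (\<exists>\<psi>. homeomorphism U (\<phi> ` U) \<phi> \<psi>)"

definition surface :: "(real^3) set \<Rightarrow> bool" where
  "surface \<Sigma> \<longleftrightarrow> (\<forall>x\<in>\<Sigma>. \<exists>U \<phi>. local_parametrization \<Sigma> U \<phi> \<and> x \<in> \<phi> ` U)"

definition tangent_space :: "(real^3) set \<Rightarrow> real^3 \<Rightarrow> (real^3) set" where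
  "tangent_space \<Sigma> x = {v. \<exists>\<gamma> \<epsilon>. \<epsilon> > 0 \<and> smooth_on \<gamma> {-\<epsilon><..<\<epsilon>} \<and> \<gamma> ` {-\<epsilon><..<\<epsilon>} \<subseteq> \<Sigma> \<and>
     \<gamma> 0 = x \<and> (\<gamma> has_vector_derivative v) (at 0)}"

definition surface_smooth_on :: "(real^3) set \<Rightarrow> (real^3) set \<Rightarrow> (real^3 \<Rightarrow> 'b::real_normed_vector) \<Rightarrow> bool" where
  "surface_smooth_on \<Sigma> W f \<longleftrightarrow>
     (\<forall>U \<phi>. local_parametrization \<Sigma> U \<phi> \<and> \<phi> ` U \<subseteq> W \<longrightarrow> smooth_on (f \<circ> \<phi>) U)"

text \<open>An orientation of a plane \<open>T\<close> is a class of ordered bases of \<open>T\<close> under base changes of positive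
  determinant.\<close>

definition same_orientation :: "'v::real_vector \<times> 'v \<Rightarrow> 'v \<times> 'v \<Rightarrow> bool" where
  "same_orientation B B' \<longleftrightarrow> (\<exists>a b c d. fst B' = a *\<^sub>R fst B + b *\<^sub>R snd B \<and>
     snd B' = c *\<^sub>R fst B + d *\<^sub>R snd B \<and> a * d - b * c > 0)"

definition plane_orientation :: "'v::real_vector set \<Rightarrow> ('v \<times> 'v) set \<Rightarrow> bool" where
  "plane_orientation T \<O> \<longleftrightarrow> (\<exists>u v. u \<noteq> v \<and> independent {u, v} \<and> span {u, v} = T \<and>
     \<O> = {B. same_orientation (u, v) B})"

definition oriented_surface :: "(real^3) set \<Rightarrow> (real^3 \<Rightarrow> ((real^3) \<times> (real^3)) set) \<Rightarrow> bool" where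
  "oriented_surface \<Sigma> \<O> \<longleftrightarrow> surface \<Sigma> \<and>
     (\<forall>x\<in>\<Sigma>. plane_orientation (tangent_space \<Sigma> x) (\<O> x)) \<and>
     (\<forall>x\<in>\<Sigma>. \<exists>U \<phi>. local_parametrization \<Sigma> U \<phi> \<and> x \<in> \<phi> ` U \<and>
        (\<forall>u\<in>U. (frechet_derivative \<phi> (at u) (1, 0), frechet_derivative \<phi> (at u) (0, 1)) \<in> \<O> (\<phi> u)))"

definition oriented_orthonormal_frame ::
  "(real^3) set \<Rightarrow> (real^3 \<Rightarrow> ((real^3) \<times> (real^3)) set) \<Rightarrow> real^3 \<Rightarrow> real^3 \<Rightarrow> real^3 \<Rightarrow> bool" where
  "oriented_orthonormal_frame \<Sigma> \<O> x e1 e2 \<longleftrightarrow>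
     e1 \<in> tangent_space \<Sigma> x \<and> e2 \<in> tangent_space \<Sigma> x \<and>
     norm e1 = 1 \<and> norm e2 = 1 \<and> e1 \<bullet> e2 = 0 \<and> (e1, e2) \<in> \<O> x"

definition positively_oriented :: "real^3 \<Rightarrow> real^3 \<Rightarrow> real^3 \<Rightarrow> bool" where
  "positively_oriented u v w \<longleftrightarrow> det (vector [u, v, w] :: real^3^3) > 0"

definition oriented_unit_normal ::
  "(real^3) set \<Rightarrow> (real^3 \<Rightarrow> ((real^3) \<times> (real^3)) set) \<Rightarrow> (real^3 \<Rightarrow> real^3) \<Rightarrow> bool" where
  "oriented_unit_normal \<Sigma> \<O> \<nu> \<longleftrightarrow>
     (\<forall>x\<in>\<Sigma>. norm (\<nu> x) = 1 \<and> (\<forall>v\<in>tangent_space \<Sigma> x. \<nu> x \<bullet> v = 0) \<and>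
        (\<forall>e1 e2. oriented_orthonormal_frame \<Sigma> \<O> x e1 e2 \<longrightarrow> positively_oriented e1 e2 (\<nu> x)))"

section \<open>Spinor bundles and spin coordinates\<close>

text \<open>The Clifford bundle of \<open>(T\<Sigma>, g\<^sub>\<Sigma>)\<close> has fibre \<open>clifford_algebra (tangent_space \<Sigma> x) (\<bullet>)\<close>,
  \<open>g\<^sub>\<Sigma>\<close> being the restriction of the inner product of \<open>\<real>\<^sup>3\<close>. The bundle of modules below has the
  trivial underlying bundle with fibre \<open>'m\<close>, whose inner product is the bundle metric: the action
  depends smoothly on the point, and tangent vectors act skew-adjointly.\<close>

abbreviation tangent_clifford_class :: "(real^3) set \<Rightarrow> real^3 \<Rightarrow> (real^3) free_algebra \<Rightarrow> (real^3) free_algebra set" where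
  "tangent_clifford_class \<Sigma> x \<equiv> cl_class (tangent_space \<Sigma> x) (\<bullet>)"

definition irreducible_clifford_bundle ::
  "(real^3) set \<Rightarrow> (real^3 \<Rightarrow> (real^3) free_algebra set \<Rightarrow> 'm::real_inner \<Rightarrow> 'm) \<Rightarrow> bool" where
  "irreducible_clifford_bundle \<Sigma> \<rho> \<longleftrightarrow>
     (\<forall>x\<in>\<Sigma>. irreducible_clifford_module (tangent_space \<Sigma> x) (\<bullet>) (\<rho> x)) \<and>
     (\<forall>x\<in>\<Sigma>. \<forall>v\<in>tangent_space \<Sigma> x. \<forall>m n.
        \<rho> x (tangent_clifford_class \<Sigma> x (fa_gen v)) m \<bullet> n =
        - (m \<bullet> \<rho> x (tangent_clifford_class \<Sigma> x (fa_gen v)) n)) \<and>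
     (\<forall>W X s. openin (top_of_set \<Sigma>) W \<and> (\<forall>x\<in>W. X x \<in> tangent_space \<Sigma> x) \<and>
        surface_smooth_on \<Sigma> W X \<and> surface_smooth_on \<Sigma> W s \<longrightarrow>
        surface_smooth_on \<Sigma> W (\<lambda>x. \<rho> x (tangent_clifford_class \<Sigma> x (fa_gen (X x))) (s x)))"

text \<open>The algebra of real-linear endomorphisms of \<open>\<bbbH>\<close> commuting with \<open>Span {1, k\<^sub>L}\<close>.\<close>

definition ref_commutant :: "(quat \<Rightarrow> quat) set" where
  "ref_commutant = {T. linear T \<and>
     (\<forall>s t q. T ((s *\<^sub>R 1 + t *\<^sub>R q\<k>) * q) = (s *\<^sub>R 1 + t *\<^sub>R q\<k>) * T q)}"

text \<open>An identification of this algebra with \<open>M\<^sub>2(\<complex>)\<close>. Since \<open>M\<^sub>2(\<complex>)\<close> acts from the right, a matrix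
  product \<open>A B\<close> corresponds to first applying the operator of \<open>A\<close>, then that of \<open>B\<close>.\<close>

definition M2C_identification :: "(complex^2^2 \<Rightarrow> quat \<Rightarrow> quat) \<Rightarrow> bool" where
  "M2C_identification \<psi> \<longleftrightarrow> bij_betw \<psi> UNIV ref_commutant \<and>
     (\<forall>A B q. \<psi> (A + B) q = \<psi> A q + \<psi> B q) \<and> (\<forall>r A q. \<psi> (r *\<^sub>R A) q = r *\<^sub>R \<psi> A q) \<and>
     \<psi> (mat 1) = id \<and> (\<forall>A B. \<psi> (A ** B) = \<psi> B \<circ> \<psi> A)"

definition right_M2C_action :: "('m::real_vector \<Rightarrow> complex^2^2 \<Rightarrow> 'm) \<Rightarrow> bool" where
  "right_M2C_action act \<longleftrightarrow> (\<forall>A. linear (\<lambda>m. act m A)) \<and> (\<forall>m. linear (act m)) \<and>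
     (\<forall>m. act m (mat 1) = m) \<and> (\<forall>m A B. act (act m A) B = act m (A ** B))"

lemma ref_commutant_eq: "ref_commutant = {LR_op q\<k> a b | a b. True}"
proof (intro equalityI subsetI)
  fix T assume T: "T \<in> ref_commutant"
  then have lin: "linear T" by (simp add: ref_commutant_def)
  have comm: "T (q\<k> * q) = q\<k> * T q" for q
  proof -
    have "T ((0 *\<^sub>R 1 + 1 *\<^sub>R q\<k>) * q) = (0 *\<^sub>R 1 + 1 *\<^sub>R q\<k>) * T q"
      using T unfolding ref_commutant_def by blast
    then show ?thesis by simp
  qed
  define u v where "u = T 1" and "v = T q\<i>"
  have j: "T q\<j> = q\<k> * v" using comm[of "q\<i>"]
    by (simp add: v_def q\<i>_def q\<j>_def q\<k>_def times_quat_def)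
  have k: "T q\<k> = q\<k> * u" using comm[of 1] by (simp add: u_def)
  have Tq: "T q = quat_re q *\<^sub>R u + quat_i q *\<^sub>R v + quat_j q *\<^sub>R (q\<k> * v) + quat_k q *\<^sub>R (q\<k> * u)" for q
  proof -
    have "q = quat_re q *\<^sub>R 1 + quat_i q *\<^sub>R q\<i> + quat_j q *\<^sub>R q\<j> + quat_k q *\<^sub>R q\<k>"
      by (simp add: quat_eq_iff q\<i>_def q\<j>_def q\<k>_def)
    then have "T q = T (quat_re q *\<^sub>R 1 + quat_i q *\<^sub>R q\<i> + quat_j q *\<^sub>R q\<j> + quat_k q *\<^sub>R q\<k>)" by simp
    also have "\<dots> = quat_re q *\<^sub>R u + quat_i q *\<^sub>R v + quat_j q *\<^sub>R (q\<k> * v) + quat_k q *\<^sub>R (q\<k> * u)"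
      by (simp add: linear_add[OF lin] linear_scale[OF lin] j k u_def v_def)
    finally show ?thesis .
  qed
  define b where "b = (1/2) *\<^sub>R (u - q\<i> * v)"
  define a where "a = (-1/2) *\<^sub>R (q\<k> * u + q\<k> * q\<i> * v)"
  have "T = LR_op q\<k> a b"
    by (rule ext)
      (simp add: Tq LR_op_def a_def b_def quat_eq_iff quat_mult_sel q\<i>_def q\<j>_def q\<k>_def field_simps)
  then show "T \<in> {LR_op q\<k> a b | a b. True}" by blast
next
  fix T assume "T \<in> {LR_op q\<k> a b | a b. True}"
  then show "T \<in> ref_commutant"
    by (auto simp: ref_commutant_def LR_op_def quat_eq_iff quat_mult_sel q\<k>_def algebra_simps
        intro!: linearI)
qed

text \<open>Writing \<open>q = z\<^sub>1 + z\<^sub>2 i\<close> with \<open>z\<^sub>1, z\<^sub>2 \<in> Span {1, k} = \<complex>\<close> identifies \<open>\<bbbH>\<close> with row vectors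
  in \<open>\<complex>\<^sup>2\<close>, on which matrices act from the right.\<close>

lemma M2C_identification_exists: "\<exists>\<psi>. M2C_identification \<psi>"
proof -
  define row :: "quat \<Rightarrow> complex^2"
    where "row q = vector [Complex (quat_re q) (quat_k q), Complex (quat_i q) (quat_j q)]" for q
  define unrow :: "complex^2 \<Rightarrow> quat"
    where "unrow z = Quat (Re (z $ 1)) (Re (z $ 2)) (Im (z $ 2)) (Im (z $ 1))" for z
  define \<psi> :: "complex^2^2 \<Rightarrow> quat \<Rightarrow> quat" where "\<psi> A q = unrow (row q v* A)" for A q
  have ru: "row (unrow z) = z" for z
    by (simp add: row_def unrow_def vec_eq_iff forall_2)
  have ur: "unrow (row q) = q" for q
    by (simp add: row_def unrow_def)
  have vm: "(z v* A) $ j = z $ 1 * A $ 1 $ j + z $ 2 * A $ 2 $ j" for z :: "complex^2" and A :: "complex^2^2" and j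
    by (simp add: vector_matrix_mult_def sum_2 mult.commute)
  have \<psi>: "\<psi> A q = Quat
      (Re (Complex (quat_re q) (quat_k q) * A $ 1 $ 1 + Complex (quat_i q) (quat_j q) * A $ 2 $ 1))
      (Re (Complex (quat_re q) (quat_k q) * A $ 1 $ 2 + Complex (quat_i q) (quat_j q) * A $ 2 $ 2))
      (Im (Complex (quat_re q) (quat_k q) * A $ 1 $ 2 + Complex (quat_i q) (quat_j q) * A $ 2 $ 2))
      (Im (Complex (quat_re q) (quat_k q) * A $ 1 $ 1 + Complex (quat_i q) (quat_j q) * A $ 2 $ 1))" for A q
    by (simp add: \<psi>_def unrow_def vm row_def)
  have mem: "\<psi> A \<in> ref_commutant" for A
    by (auto simp: ref_commutant_def \<psi> quat_eq_iff quat_mult_sel q\<k>_def algebra_simps intro!: linearI)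
  have "inj \<psi>"
  proof (rule injI)
    fix A B assume eq: "\<psi> A = \<psi> B"
    have "\<psi> A 1 = \<psi> B 1" "\<psi> A q\<i> = \<psi> B q\<i>" using eq by simp_all
    then show "A = B" by (simp add: \<psi> q\<i>_def vec_eq_iff forall_2 complex_eq_iff)
  qed
  moreover have "T \<in> range \<psi>" if T_mem: "T \<in> ref_commutant" for T
  proof -
    obtain a b where T: "T = LR_op q\<k> a b" using T_mem unfolding ref_commutant_eq by auto
    have "T = \<psi> (vector [row (T 1), row (T q\<i>)])"
      by (rule ext)
        (simp add: T LR_op_def \<psi> row_def quat_eq_iff quat_mult_sel q\<i>_def q\<k>_def algebra_simps)
    then show ?thesis by blast
  qed
  ultimately have "bij_betw \<psi> UNIV ref_commutant"
    using mem by (auto simp: bij_betw_def)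
  moreover have "\<psi> (A ** B) = \<psi> B \<circ> \<psi> A" for A B
    by (rule ext) (simp add: \<psi>_def ru vector_matrix_mul_assoc)
  ultimately have "M2C_identification \<psi>"
    by (auto simp: M2C_identification_def \<psi> quat_eq_iff algebra_simps mat_def fun_eq_iff)
  then show ?thesis by blast
qed

text \<open>The fibre over every point is \<open>\<bbbH>\<close> itself; \<open>(k\<^sub>L a\<^sub>R + b\<^sub>R)\<close> on the source corresponds to
  \<open>(\<nu>\<^sub>x)\<^sub>L a\<^sub>R + b\<^sub>R\<close> on the target, and \<open>n\<close> stands for \<open>\<nu>\<^sub>x\<close>.\<close>

definition spin_coordinate_system ::
  "real^3 \<Rightarrow> real^3 \<Rightarrow> real^3 \<Rightarrow> (quat \<Rightarrow> quat) \<Rightarrow> bool" where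
  "spin_coordinate_system n e1 e2 \<Phi> \<longleftrightarrow>
     orthogonal_transformation \<Phi> \<and>
     (\<forall>a b q. \<Phi> (LR_op q\<k> a b q) = LR_op (im_quat n) a b (\<Phi> q)) \<and>
     (\<forall>(a::real) (b::real) q.
        \<Phi> ((a *\<^sub>R q\<i> + b *\<^sub>R q\<j>) * q) = im_quat (a *\<^sub>R e1 + b *\<^sub>R e2) * \<Phi> q)"

end

theory Submission
  imports Defs
begin

text \<open>Everything rests on one formula for imaginary quaternions,
  \<open>v w = v \<times> w - v \<bullet> w\<close> (\<open>im_quat_mult\<close>), with the cross product written
  \<open>cross3\<close> in the code. Its symmetric part says that left multiplication satisfies the Clifford
  relations, so the universal property (\<open>clifford_lift_class\<close>) extends it from the tangent
  plane to the whole Clifford algebra. As every element acts by a left multiplication, the action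
  commutes with right multiplications. The same formula gives the other structure: two independent
  tangent vectors \<open>u\<close>, \<open>v\<close> generate, together with \<open>u v\<close>, all left
  multiplications, so the fibres are irreducible (\<open>invariant_subspace_trivial\<close>); the unit
  normal squares to \<open>-1\<close>, as \<open>k\<close> does, so replacing \<open>k\<close> by
  \<open>\<nu>\<^sub>x\<close> in \<open>k\<^sub>L a\<^sub>R + b\<^sub>R\<close> preserves composition
  (\<open>transport_op_right_action\<close>); and the normal anticommutes with tangent vectors, hence commutes
  with even elements (\<open>clifford_lift_even_commute\<close>). Smoothness of the bundle is the product
  rule (\<open>Ck_on_bilinear\<close>).

  A spin coordinate system \<open>\<Phi>\<close> commutes with right multiplications (the case
  \<open>a = 0\<close>), so it is left multiplication by \<open>h = \<Phi>(1)\<close>, and the remaining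
  conditions say that \<open>h\<close> is a unit quaternion conjugating \<open>i\<close>, \<open>j\<close>,
  \<open>k\<close> to \<open>e\<^sub>1\<close>, \<open>e\<^sub>2\<close>, \<open>\<nu>\<^sub>x\<close>
  (\<open>spin_coordinate_system_iff\<close>). Two such quaternions \<open>g\<close> and \<open>h\<close> differ by a
  unit \<open>g\<inverse> h\<close> that commutes with \<open>i\<close> and \<open>j\<close>; this is a real
  number, so \<open>h = \<plusminus>g\<close>.\<close>

section \<open>The universal property of the Clifford algebra\<close>

definition fa_lift :: "('v \<Rightarrow> 'a::real_algebra_1) \<Rightarrow> 'v free_algebra \<Rightarrow> 'a" where
  "fa_lift f p = (\<Sum>w\<in>Poly_Mapping.keys p. Poly_Mapping.lookup p w *\<^sub>R prod_list (map f (letters w)))"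

lemma fa_lift_zero [simp]: "fa_lift f 0 = 0"
  by (simp add: fa_lift_def)

lemma fa_lift_single [simp]:
  "fa_lift f (Poly_Mapping.single w r) = r *\<^sub>R prod_list (map f (letters w))"
  by (simp add: fa_lift_def)

lemma fa_lift_scalar [simp]: "fa_lift f (fa_scalar r) = r *\<^sub>R 1"
  by (simp add: fa_scalar_def zero_word_def)

lemma fa_lift_gen [simp]: "fa_lift f (fa_gen v) = f v"
  by (simp add: fa_gen_def)

lemma fa_lift_add [simp]: "fa_lift f (p + q) = fa_lift f p + fa_lift f q"
  unfolding fa_lift_def
  by (rule setsum_keys_plus_distrib) (simp_all add: scaleR_add_left)

lemma fa_lift_diff [simp]: "fa_lift f (p - q) = fa_lift f p - fa_lift f q"
  using fa_lift_add[of f "p - q" q] by (simp add: algebra_simps)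

lemma fa_lift_sum [simp]: "fa_lift f (\<Sum>i\<in>I. p i) = (\<Sum>i\<in>I. fa_lift f (p i))"
  by (induction I rule: infinite_finite_induct) simp_all

lemma sum_monomials:
  "(\<Sum>w\<in>Poly_Mapping.keys p. Poly_Mapping.single w (Poly_Mapping.lookup p w)) = p"
  by (rule poly_mapping_eqI)
    (simp add: lookup_sum lookup_single when_def in_keys_iff)

text \<open>Both sides are bilinear, so it suffices to compare them on pairs of words, where the product is
  concatenation.\<close>

lemma fa_lift_mult [simp]: "fa_lift f (p * q) = fa_lift f p * fa_lift f q"
proof -
  have "p * q = (\<Sum>v\<in>Poly_Mapping.keys p. \<Sum>w\<in>Poly_Mapping.keys q.
      Poly_Mapping.single (v + w) (Poly_Mapping.lookup p v * Poly_Mapping.lookup q w))"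
    by (subst (1) sum_monomials[of p, symmetric], subst (1) sum_monomials[of q, symmetric])
      (simp only: sum_product mult_single)
  also have "fa_lift f \<dots> = fa_lift f p * fa_lift f q"
    by (simp add: fa_lift_def[of f p] fa_lift_def[of f q] sum_product plus_word_def mult.commute)
  finally show ?thesis .
qed

text \<open>The data to which the universal property applies; \<open>f\<close> is constrained on \<open>V\<close> only, since
  \<open>V\<close> is a set rather than a type.\<close>

definition clifford_map :: "'v::real_vector set \<Rightarrow> ('v \<Rightarrow> 'v \<Rightarrow> real) \<Rightarrow> ('v \<Rightarrow> 'a::real_algebra_1) \<Rightarrow> bool" where
  "clifford_map V g f \<longleftrightarrow>
     (\<forall>v\<in>V. \<forall>w\<in>V. f (v + w) = f v + f w) \<and> (\<forall>v\<in>V. \<forall>r. f (r *\<^sub>R v) = r *\<^sub>R f v) \<and>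
     (\<forall>v\<in>V. \<forall>w\<in>V. f v * f w + f w * f v = (- 2 * g v w) *\<^sub>R 1)"

lemma fa_lift_clifford_ideal:
  assumes "clifford_map V g f" "p \<in> clifford_ideal V g"
  shows "fa_lift f p = 0"
  using assms(2)
proof induction
  case (add_rel v w)
  then show ?case using assms(1) by (simp add: clifford_map_def)
next
  case (scale_rel v r)
  then show ?case using assms(1) by (simp add: clifford_map_def)
next
  case (clifford_rel v w)
  then have "f v * f w + f w * f v = (- 2 * g v w) *\<^sub>R 1"
    using assms(1) unfolding clifford_map_def by blast
  then show ?case by simp
qed simp_all

text \<open>A residue class determines the common value of \<open>fa_lift f\<close> on its members without reference
  to \<open>V\<close> or \<open>g\<close>; a single lift therefore serves all tangent planes.\<close>

definition clifford_lift :: "('v \<Rightarrow> 'a::real_algebra_1) \<Rightarrow> 'v free_algebra set \<Rightarrow> 'a" where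
  "clifford_lift f A = (THE a. fa_lift f ` A = {a})"

lemma clifford_lift_class:
  assumes "clifford_map V g f" "p \<in> free_algebra_on V"
  shows "clifford_lift f (cl_class V g p) = fa_lift f p"
proof -
  have "fa_lift f q = fa_lift f p" if "q \<in> cl_class V g p" for q
    using fa_lift_clifford_ideal[OF assms(1), of "q - p"] that by (simp add: cl_class_def)
  moreover have "p \<in> cl_class V g p"
    using assms(2) by (simp add: cl_class_def clifford_ideal.zero)
  ultimately have "fa_lift f ` cl_class V g p = {fa_lift f p}" by blast
  then show ?thesis by (simp add: clifford_lift_def)
qed

lemma free_algebra_on_scalar: "fa_scalar r \<in> free_algebra_on V"
  by (simp add: free_algebra_on_def fa_scalar_def zero_word_def)

lemma free_algebra_on_gen: "v \<in> V \<Longrightarrow> fa_gen v \<in> free_algebra_on V"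
  by (simp add: free_algebra_on_def fa_gen_def)

lemma free_algebra_on_add:
  "p \<in> free_algebra_on V \<Longrightarrow> q \<in> free_algebra_on V \<Longrightarrow> p + q \<in> free_algebra_on V"
  unfolding free_algebra_on_def using keys_add[of p q] by blast

lemma free_algebra_on_mult:
  "p \<in> free_algebra_on V \<Longrightarrow> q \<in> free_algebra_on V \<Longrightarrow> p * q \<in> free_algebra_on V"
  unfolding free_algebra_on_def using keys_mult[of p q] by (fastforce simp: plus_word_def)

lemma clifford_module_lift:
  assumes "clifford_map V g f"
  shows "clifford_module V g (\<lambda>A m. clifford_lift f A * m)"
  unfolding clifford_module_def
  by (auto simp: clifford_lift_class[OF assms] free_algebra_on_scalar free_algebra_on_add
      free_algebra_on_mult fun_eq_iff algebra_simps intro!: linearI)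

text \<open>Moving \<open>n\<close> past a word costs one sign per letter, and even words have an even number
  of letters.\<close>

lemma clifford_lift_even_commute:
  assumes f: "clifford_map V g f" and A: "A \<in> clifford_even V g"
    and anti: "\<And>v. v \<in> V \<Longrightarrow> f v * n = - (n * f v)"
  shows "clifford_lift f A * n = n * clifford_lift f A"
proof -
  obtain p where p: "p \<in> free_algebra_on V" "A = cl_class V g p"
    "\<forall>w\<in>Poly_Mapping.keys p. even (length (letters w))"
    using A unfolding clifford_even_def by blast
  have sign: "prod_list (map f vs) * n = (-1) ^ length vs * (n * prod_list (map f vs))"
    if "set vs \<subseteq> V" for vs
    using that
  proof (induction vs)
    case (Cons v vs)
    have "prod_list (map f (v # vs)) * n = f v * (prod_list (map f vs) * n)"
      by (simp add: mult.assoc)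
    also have "\<dots> = (-1) ^ length vs * ((f v * n) * prod_list (map f vs))"
      using Cons by (cases "even (length vs)") (simp_all add: mult.assoc)
    also have "\<dots> = (-1) ^ length (v # vs) * (n * prod_list (map f (v # vs)))"
      using Cons.prems anti[of v] by (simp add: mult.assoc)
    finally show ?case .
  qed simp
  have "fa_lift f p * n = n * fa_lift f p"
    unfolding fa_lift_def sum_distrib_left sum_distrib_right
  proof (rule sum.cong[OF refl])
    fix w assume "w \<in> Poly_Mapping.keys p"
    then have "prod_list (map f (letters w)) * n = n * prod_list (map f (letters w))"
      using sign[of "letters w"] p by (auto simp: free_algebra_on_def)
    then show "Poly_Mapping.lookup p w *\<^sub>R prod_list (map f (letters w)) * n
        = n * Poly_Mapping.lookup p w *\<^sub>R prod_list (map f (letters w))"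
      by simp
  qed
  then show ?thesis by (simp add: p clifford_lift_class[OF f])
qed

section \<open>Products of smooth maps\<close>

text \<open>Openness makes the values on the set determine the derivatives there. This is needed because the
  derivative of a product is given by the product rule on the set only.\<close>

lemma Ck_on_cong:
  assumes "open S" "Ck_on k f S" "\<And>x. x \<in> S \<Longrightarrow> f x = h x"
  shows "Ck_on k h S"
  using assms(2,3)
proof (induction k arbitrary: f h)
  case 0
  then show ?case by (auto cong: continuous_on_cong)
next
  case (Suc k)
  have "h differentiable (at x)" if "x \<in> S" for x
    using Suc.prems that assms(1) unfolding differentiable_def
    by (metis Ck_on.simps(2) differentiable_def has_derivative_transform_within_open)
  moreover have "Ck_on k (\<lambda>x. frechet_derivative h (at x) v) S" for v
  proof (rule Suc.IH)
    show "Ck_on k (\<lambda>x. frechet_derivative f (at x) v) S" using Suc.prems(1) by simp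
    show "frechet_derivative f (at x) v = frechet_derivative h (at x) v" if "x \<in> S" for x
      using frechet_derivative_transform_within_open[of f x S h] Suc.prems assms(1) that by simp
  qed
  ultimately show ?case by simp
qed

lemma Ck_on_SucD: "Ck_on (Suc k) f S \<Longrightarrow> Ck_on k f S"
proof (induction k arbitrary: f)
  case 0
  then show ?case
    by (simp add: continuous_at_imp_continuous_on differentiable_imp_continuous_within)
next
  case (Suc k)
  then show ?case by (metis Ck_on.simps(2))
qed

lemma Ck_on_add:
  assumes "open S" "Ck_on k f S" "Ck_on k h S"
  shows "Ck_on k (\<lambda>x. f x + h x) S"
  using assms(2,3)
proof (induction k arbitrary: f h)
  case 0
  then show ?case by (auto intro: continuous_on_add)
next
  case (Suc k)
  have der: "((\<lambda>x. f x + h x) has_derivative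
      (\<lambda>v. frechet_derivative f (at x) v + frechet_derivative h (at x) v)) (at x)" if "x \<in> S" for x
    using Suc.prems that by (auto simp: frechet_derivative_works intro!: has_derivative_add)
  have "Ck_on k (\<lambda>x. frechet_derivative (\<lambda>x. f x + h x) (at x) v) S" for v
    by (rule Ck_on_cong[OF assms(1) Suc.IH])
      (use Suc.prems in \<open>auto simp flip: frechet_derivative_at[OF der]\<close>)
  then show ?case using der by (auto intro: differentiableI)
qed

text \<open>The derivative of a product is a sum of two products of maps of class one lower; the undifferentiated
  factors drop one class by \<open>Ck_on_SucD\<close>, so the induction hypothesis applies to both.\<close>

lemma Ck_on_bilinear:
  assumes "open S" "bounded_bilinear B" "Ck_on k f S" "Ck_on k h S"
  shows "Ck_on k (\<lambda>x. B (f x) (h x)) S"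
  using assms(3,4)
proof (induction k arbitrary: f h)
  case 0
  then show ?case using bounded_bilinear.continuous_on[OF assms(2)] by simp
next
  case (Suc k)
  have der: "((\<lambda>x. B (f x) (h x)) has_derivative
      (\<lambda>v. B (f x) (frechet_derivative h (at x) v) + B (frechet_derivative f (at x) v) (h x))) (at x)"
    if "x \<in> S" for x
    using Suc.prems that
    by (auto simp: frechet_derivative_works intro!: bounded_bilinear.FDERIV[OF assms(2)])
  have "Ck_on k f S" "Ck_on k h S" using Suc.prems by (auto intro: Ck_on_SucD)
  then have "Ck_on k (\<lambda>x. frechet_derivative (\<lambda>x. B (f x) (h x)) (at x) v) S" for v
    by (intro Ck_on_cong[OF assms(1) Ck_on_add[OF assms(1) Suc.IH Suc.IH]])
      (use Suc.prems in \<open>auto simp flip: frechet_derivative_at[OF der]\<close>)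
  then show ?case using der by (auto intro: differentiableI)
qed

section \<open>Imaginary quaternions\<close>

lemma im_quat_sel [simp]:
  "quat_re (im_quat v) = 0" "quat_i (im_quat v) = v $ 1"
  "quat_j (im_quat v) = v $ 2" "quat_k (im_quat v) = v $ 3"
  by (simp_all add: im_quat_def)

lemma im_quat_linear: "im_quat (v + w) = im_quat v + im_quat w" "im_quat (r *\<^sub>R v) = r *\<^sub>R im_quat v"
  by (simp_all add: quat_eq_iff)

lemma im_quat_axis: "im_quat (axis 1 1) = q\<i>" "im_quat (axis 2 1) = q\<j>" "im_quat (axis 3 1) = q\<k>"
  by (simp_all add: quat_eq_iff q\<i>_def q\<j>_def q\<k>_def axis_def)

lemma im_quat_mult: "im_quat v * im_quat w = im_quat (cross3 v w) - (v \<bullet> w) *\<^sub>R 1"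
  by (simp add: quat_eq_iff quat_mult_sel cross_components inner_vec_def sum_3)

lemma im_quat_anticommute: "im_quat v * im_quat w + im_quat w * im_quat v = (- 2 * (v \<bullet> w)) *\<^sub>R 1"
  by (simp add: im_quat_mult cross_skew[of w v] inner_commute[of w v] quat_eq_iff)

lemma clifford_map_im_quat: "clifford_map V (\<bullet>) im_quat"
  unfolding clifford_map_def by (simp add: im_quat_linear im_quat_anticommute del: mult_minus_left)

lemma bounded_linear_im_quat: "bounded_linear im_quat"
proof (rule bounded_linear_intro)
  show "norm (im_quat v) \<le> norm v * 1" for v
    by (simp add: norm_eq_sqrt_inner quat_inner_sel inner_vec_def sum_3)
qed (simp_all add: im_quat_linear)

lemma im_quat_skew_adjoint: "(im_quat v * p) \<bullet> q = - (p \<bullet> (im_quat v * q))"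
  by (simp add: quat_inner_sel quat_mult_sel algebra_simps)

text \<open>Cramer's rule in the basis \<open>u\<close>, \<open>v\<close>, \<open>w = u \<times> v\<close>, whose determinant is
  \<open>w \<bullet> w\<close>. It expands any vector without first orthonormalizing \<open>u\<close> and \<open>v\<close>.\<close>

lemma cramer_cross3:
  fixes u v y :: "real^3"
  defines "w \<equiv> cross3 u v"
  shows "(w \<bullet> w) *\<^sub>R y = (y \<bullet> cross3 v w) *\<^sub>R u + (y \<bullet> cross3 w u) *\<^sub>R v + (y \<bullet> w) *\<^sub>R w"
  unfolding w_def vec_eq_iff forall_3
  by (simp only: cross_components inner_vec_def sum_3 inner_real_def vector_add_component
      vector_scaleR_component real_scaleR_def, intro conjI; algebra)

text \<open>Stability under \<open>u\<close> and \<open>v\<close> gives stability under their product, hence under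
  \<open>u \<times> v\<close>, hence under all imaginary quaternions and finally under all of \<open>\<bbbH>\<close>. So the subspace is a
  left ideal of a division algebra.\<close>

lemma invariant_subspace_trivial:
  fixes S :: "quat set"
  assumes S: "subspace S" and uv: "cross3 u v \<noteq> 0"
    and u: "\<And>q. q \<in> S \<Longrightarrow> im_quat u * q \<in> S" and v: "\<And>q. q \<in> S \<Longrightarrow> im_quat v * q \<in> S"
  shows "S = {0} \<or> S = UNIV"
proof (cases "S = {0}")
  case False
  define w where "w = cross3 u v"
  have w: "im_quat w * q \<in> S" if "q \<in> S" for q
  proof -
    have "im_quat w * q = im_quat u * (im_quat v * q) + (u \<bullet> v) *\<^sub>R q"
      by (simp add: w_def im_quat_mult algebra_simps flip: mult.assoc)
    then show ?thesis using S u v that by (simp add: subspace_add subspace_scale)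
  qed
  have im: "im_quat y * q \<in> S" if "q \<in> S" for y q
  proof -
    have "(w \<bullet> w) *\<^sub>R (im_quat y * q) = (y \<bullet> cross3 v w) *\<^sub>R (im_quat u * q)
        + (y \<bullet> cross3 w u) *\<^sub>R (im_quat v * q) + (y \<bullet> w) *\<^sub>R (im_quat w * q)"
      using arg_cong[OF cramer_cross3[of u v y], of "\<lambda>z. im_quat z * q"]
      by (simp add: w_def im_quat_linear distrib_right)
    also have "\<dots> \<in> S" using S u v w that by (simp add: subspace_add subspace_scale)
    finally have "(1 / (w \<bullet> w)) *\<^sub>R (w \<bullet> w) *\<^sub>R (im_quat y * q) \<in> S" by (rule subspace_scale[OF S])
    then show ?thesis using uv by (simp add: w_def)
  qed
  obtain m where m: "m \<in> S" "m \<noteq> 0" using False subspace_0[OF S] by blast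
  have "q \<in> S" for q
  proof -
    define p where "p = q * inverse m"
    have "p = quat_re p *\<^sub>R 1 + im_quat (vector [quat_i p, quat_j p, quat_k p])"
      by (simp add: quat_eq_iff)
    then have "p * m = quat_re p *\<^sub>R m + im_quat (vector [quat_i p, quat_j p, quat_k p]) * m"
      by (metis distrib_right mult_1_left mult_scaleR_left)
    also have "\<dots> \<in> S" using S m im by (simp add: subspace_add subspace_scale)
    finally show ?thesis using m by (simp add: p_def mult.assoc)
  qed
  then show ?thesis by blast
qed simp

section \<open>The Clifford module bundle over an oriented surface\<close>

lemma plane_orientation_cross3:
  assumes "plane_orientation T \<O>"
  obtains u v where "u \<in> T" "v \<in> T" "cross3 u v \<noteq> 0"
proof -
  obtain u v where uv: "u \<noteq> v" "independent {u, v}" "span {u, v} = T"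
    using assms unfolding plane_orientation_def by blast
  have "independent {v, u}" using uv(2) by (simp add: insert_commute)
  then have "v \<notin> span {u}" using uv(1) by (simp add: independent_insert)
  moreover have "u \<noteq> 0" using uv(2) dependent_zero by blast
  ultimately have "\<not> collinear {0, u, v}"
    by (auto simp: collinear_lemma span_singleton)
  then show ?thesis using that[of u v] uv(3) by (auto simp: cross_eq_0 intro: span_base)
qed

lemma irreducible_clifford_module_im_quat:
  assumes "plane_orientation T \<O>"
  shows "irreducible_clifford_module T (\<bullet>) (\<lambda>A q. clifford_lift im_quat A * q)"
proof -
  obtain u v where uv: "u \<in> T" "v \<in> T" "cross3 u v \<noteq> 0"
    using plane_orientation_cross3[OF assms] .
  have stable: "im_quat y * q \<in> S"
    if "\<forall>A\<in>clifford_algebra T (\<bullet>). (\<lambda>q. clifford_lift im_quat A * q) ` S \<subseteq> S" "y \<in> T" "q \<in> S" for S y q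
  proof -
    have "cl_class T (\<bullet>) (fa_gen y) \<in> clifford_algebra T (\<bullet>)"
      using that(2) by (simp add: clifford_algebra_def free_algebra_on_gen)
    then have "clifford_lift im_quat (cl_class T (\<bullet>) (fa_gen y)) * q \<in> S" using that by blast
    then show ?thesis
      using that(2) by (simp add: clifford_lift_class[OF clifford_map_im_quat] free_algebra_on_gen)
  qed
  have "\<exists>m::quat. m \<noteq> 0" by (rule exI[of _ 1]) simp
  then show ?thesis
    unfolding irreducible_clifford_module_def
    using clifford_module_lift[OF clifford_map_im_quat] uv stable
    by (meson invariant_subspace_trivial)
qed

lemma irreducible_clifford_bundle_im_quat:
  assumes "oriented_surface \<Sigma> \<O>"
  shows "irreducible_clifford_bundle \<Sigma> (\<lambda>x A q. clifford_lift im_quat A * q)"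
proof -
  have gen: "clifford_lift im_quat (tangent_clifford_class \<Sigma> x (fa_gen v)) = im_quat v"
    if "v \<in> tangent_space \<Sigma> x" for x v
    using that by (simp add: clifford_lift_class[OF clifford_map_im_quat] free_algebra_on_gen)
  have smooth: "surface_smooth_on \<Sigma> W (\<lambda>x. clifford_lift im_quat (tangent_clifford_class \<Sigma> x (fa_gen (X x))) * s x)"
    if "\<forall>x\<in>W. X x \<in> tangent_space \<Sigma> x" "surface_smooth_on \<Sigma> W X" "surface_smooth_on \<Sigma> W s" for W X s
    unfolding surface_smooth_on_def smooth_on_def
  proof (intro allI impI)
    fix U \<phi> k assume \<phi>: "local_parametrization \<Sigma> U \<phi> \<and> \<phi> ` U \<subseteq> W"
    then have U: "open U" by (simp add: local_parametrization_def)
    have "Ck_on k (X \<circ> \<phi>) U" "Ck_on k (s \<circ> \<phi>) U"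
      using that(2,3) \<phi> unfolding surface_smooth_on_def smooth_on_def by blast+
    moreover have "bounded_bilinear (\<lambda>v q. im_quat v * q)"
      by (rule bounded_bilinear.comp1[OF bounded_bilinear_mult bounded_linear_im_quat])
    ultimately have "Ck_on k (\<lambda>u. im_quat ((X \<circ> \<phi>) u) * (s \<circ> \<phi>) u) U"
      by (intro Ck_on_bilinear[OF U, of "\<lambda>v q. im_quat v * q"])
    then show "Ck_on k ((\<lambda>x. clifford_lift im_quat (tangent_clifford_class \<Sigma> x (fa_gen (X x))) * s x) \<circ> \<phi>) U"
      by (rule Ck_on_cong[OF U]) (use \<phi> that(1) gen in auto)
  qed
  show ?thesis
    unfolding irreducible_clifford_bundle_def
    using assms irreducible_clifford_module_im_quat smooth
    by (auto simp: oriented_surface_def gen im_quat_skew_adjoint)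
qed

section \<open>The right action of the matrix algebra\<close>

text \<open>The values of the operator at \<open>1\<close> and \<open>i\<close> are \<open>k a + b\<close> and \<open>j a + i b\<close>,
  from which \<open>a\<close> and \<open>b\<close> can be recovered.\<close>

lemma LR_op_inject: "LR_op q\<k> a b = LR_op q\<k> a' b' \<longleftrightarrow> a = a' \<and> b = b'"
proof
  assume eq: "LR_op q\<k> a b = LR_op q\<k> a' b'"
  have "LR_op q\<k> a b 1 = LR_op q\<k> a' b' 1" "LR_op q\<k> a b q\<i> = LR_op q\<k> a' b' q\<i>"
    using eq by simp_all
  then show "a = a' \<and> b = b'"
    by (simp add: LR_op_def quat_eq_iff quat_mult_sel q\<i>_def q\<k>_def)
qed simp

text \<open>The correspondence \<open>k\<^sub>L a\<^sub>R + b\<^sub>R \<mapsto> n\<^sub>L a\<^sub>R + b\<^sub>R\<close>. The coefficients are unique by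
  \<open>LR_op_inject\<close>; operators outside the commutant get an unspecified value.\<close>

definition transport_op :: "quat \<Rightarrow> (quat \<Rightarrow> quat) \<Rightarrow> quat \<Rightarrow> quat" where
  "transport_op n T = (case (THE (a, b). T = LR_op q\<k> a b) of (a, b) \<Rightarrow> LR_op n a b)"

lemma transport_op_LR_op: "transport_op n (LR_op q\<k> a b) = LR_op n a b"
proof -
  have "(THE (c, d). LR_op q\<k> a b = LR_op q\<k> c d) = (a, b)"
    by (rule the_equality) (auto simp: LR_op_inject)
  then show ?thesis by (simp add: transport_op_def)
qed

text \<open>The coefficients of the composite do not depend on \<open>n\<close>. That is why exchanging one square root of
  \<open>-1\<close> for another is multiplicative.\<close>

lemma LR_op_comp:
  assumes "n * n = - 1"
  shows "LR_op n a' b' \<circ> LR_op n a b = LR_op n (b * a' + a * b') (b * b' - a * a')"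
proof
  fix q
  have "n * (n * x) = - x" for x using assms by (metis mult.assoc mult_minus1)
  then show "(LR_op n a' b' \<circ> LR_op n a b) q = LR_op n (b * a' + a * b') (b * b' - a * a') q"
    by (simp add: LR_op_def algebra_simps)
qed

text \<open>An identification with the matrix algebra amounts to coefficient functions \<open>a\<close>, \<open>b\<close> on
  matrices. By injectivity of the coefficients, the laws of the reference action become identities between
  these functions, and the identities give the same laws for any \<open>n\<close> with \<open>n\<^sup>2 = -1\<close>.\<close>

lemma transport_op_right_action:
  assumes n: "n * n = - 1" and \<psi>: "M2C_identification \<psi>"
  shows "right_M2C_action (\<lambda>q M. transport_op n (\<psi> M) q)"
proof -
  have "\<exists>a b. \<psi> M = LR_op q\<k> a b" for M
    using \<psi> unfolding M2C_identification_def bij_betw_def ref_commutant_eq by blast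
  then obtain a b where ab: "\<psi> M = LR_op q\<k> (a M) (b M)" for M by metis
  have k: "q\<k> * q\<k> = - 1" by (simp add: quat_eq_iff quat_mult_sel q\<k>_def)
  have T: "transport_op n (\<psi> M) = LR_op n (a M) (b M)" for M
    by (simp add: ab transport_op_LR_op)
  have hom: "\<And>A B q. \<psi> (A + B) q = \<psi> A q + \<psi> B q" "\<And>r A q. \<psi> (r *\<^sub>R A) q = r *\<^sub>R \<psi> A q"
    "\<psi> (mat 1) = id" "\<And>A B. \<psi> (A ** B) = \<psi> B \<circ> \<psi> A"
    using \<psi> unfolding M2C_identification_def by blast+
  have "LR_op q\<k> (a (A + B)) (b (A + B)) = LR_op q\<k> (a A + a B) (b A + b B)" for A B
    by (rule ext) (use hom(1)[of A B] in \<open>simp add: ab\<close>, simp add: LR_op_def distrib_left)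
  then have add: "a (A + B) = a A + a B" "b (A + B) = b A + b B" for A B
    by (simp_all add: LR_op_inject)
  have "LR_op q\<k> (a (r *\<^sub>R A)) (b (r *\<^sub>R A)) = LR_op q\<k> (r *\<^sub>R a A) (r *\<^sub>R b A)" for r A
    by (rule ext) (use hom(2)[of r A] in \<open>simp add: ab\<close>, simp add: LR_op_def scaleR_add_right)
  then have scale: "a (r *\<^sub>R A) = r *\<^sub>R a A" "b (r *\<^sub>R A) = r *\<^sub>R b A" for r A
    by (simp_all add: LR_op_inject)
  have "LR_op q\<k> (a (mat 1)) (b (mat 1)) = LR_op q\<k> 0 1"
    using hom(3) by (simp add: ab fun_eq_iff LR_op_def)
  then have one: "a (mat 1) = 0" "b (mat 1) = 1"
    by (simp_all add: LR_op_inject)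
  have "LR_op q\<k> (a (A ** B)) (b (A ** B)) = LR_op q\<k> (a B) (b B) \<circ> LR_op q\<k> (a A) (b A)" for A B
    using hom(4) by (simp add: ab)
  then have mult: "a (A ** B) = b A * a B + a A * b B" "b (A ** B) = b A * b B - a A * a B" for A B
    by (simp_all add: LR_op_inject LR_op_comp[OF k])
  have "LR_op n (a B) (b B) (LR_op n (a A) (b A) m) = LR_op n (a (A ** B)) (b (A ** B)) m" for m A B
    using LR_op_comp[OF n, of "a B" "b B" "a A" "b A"] by (simp add: mult fun_eq_iff)
  moreover have "linear (\<lambda>m. LR_op n (a A) (b A) m)" for A
    by (rule linearI) (simp_all add: LR_op_def algebra_simps)
  moreover have "linear (\<lambda>M. LR_op n (a M) (b M) m)" for m
    by (rule linearI) (simp_all add: LR_op_def add scale algebra_simps)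
  moreover have "LR_op n (a (mat 1)) (b (mat 1)) m = m" for m
    by (simp add: LR_op_def one)
  ultimately show ?thesis by (simp add: right_M2C_action_def T)
qed

section \<open>Spin coordinate systems\<close>

lemma orthogonal_transformation_mult_left:
  fixes h :: quat
  assumes "norm h = 1"
  shows "orthogonal_transformation (\<lambda>q. h * q)"
  using assms by (simp add: orthogonal_transformation norm_mult linear_iff algebra_simps)

lemma commute_i_j_real:
  fixes c :: quat
  assumes "c * q\<i> = q\<i> * c" "c * q\<j> = q\<j> * c"
  shows "c = quat_re c *\<^sub>R 1"
  using assms by (simp add: quat_eq_iff quat_mult_sel q\<i>_def q\<j>_def)

text \<open>The case \<open>a = 0\<close> of the intertwining condition is compatibility with right multiplication,
  which forces \<open>\<Phi>(q) = \<Phi>(1) q\<close>; the other conditions need then be tested at \<open>q = 1\<close> only.\<close>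

lemma spin_coordinate_system_iff:
  "spin_coordinate_system n e1 e2 \<Phi> \<longleftrightarrow>
     (\<exists>h. norm h = 1 \<and> h * q\<i> = im_quat e1 * h \<and> h * q\<j> = im_quat e2 * h \<and>
          h * q\<k> = im_quat n * h \<and> \<Phi> = (\<lambda>q. h * q))"
  (is "?L \<longleftrightarrow> (\<exists>h. ?R h)")
proof
  assume ?L
  then have orth: "orthogonal_transformation \<Phi>"
    and LR: "\<And>a b q. \<Phi> (LR_op q\<k> a b q) = LR_op (im_quat n) a b (\<Phi> q)"
    and cl: "\<And>a b q. \<Phi> ((a *\<^sub>R q\<i> + b *\<^sub>R q\<j>) * q) = im_quat (a *\<^sub>R e1 + b *\<^sub>R e2) * \<Phi> q"
    unfolding spin_coordinate_system_def by blast+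
  have right: "\<Phi> q = \<Phi> 1 * q" for q
    using LR[of 0 q 1] by (simp add: LR_op_def)
  have "\<Phi> q\<i> = im_quat e1 * \<Phi> 1" "\<Phi> q\<j> = im_quat e2 * \<Phi> 1" "\<Phi> q\<k> = im_quat n * \<Phi> 1"
    using cl[of 1 0 1] cl[of 0 1 1] LR[of 1 0 1] by (simp_all add: LR_op_def)
  moreover have "norm (\<Phi> 1) = 1"
    using orth by (simp add: orthogonal_transformation)
  ultimately have "?R (\<Phi> 1)"
    using right by (metis ext)
  then show "\<exists>h. ?R h" ..
next
  assume "\<exists>h. ?R h"
  then obtain h where h: "norm h = 1" "h * q\<i> = im_quat e1 * h" "h * q\<j> = im_quat e2 * h"
    "h * q\<k> = im_quat n * h" and \<Phi>: "\<Phi> = (\<lambda>q. h * q)" by blast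
  have h': "h * (q\<i> * q) = im_quat e1 * (h * q)" "h * (q\<j> * q) = im_quat e2 * (h * q)"
    "h * (q\<k> * q) = im_quat n * (h * q)" for q
    using h(2-4) by (simp_all flip: mult.assoc)
  show ?L
    unfolding spin_coordinate_system_def \<Phi>
    using orthogonal_transformation_mult_left[OF h(1)]
    by (simp add: LR_op_def algebra_simps h' im_quat_linear)
qed

text \<open>If \<open>g\<close> and \<open>h\<close> both intertwine, \<open>g\<inverse> h\<close> commutes with \<open>i\<close> and \<open>j\<close>, so it is a
  real number of absolute value \<open>1\<close>.\<close>

lemma spin_coordinate_systems_eq:
  assumes "norm g = 1" "g * q\<i> = im_quat e1 * g" "g * q\<j> = im_quat e2 * g" "g * q\<k> = im_quat n * g"
  shows "{\<Phi>. spin_coordinate_system n e1 e2 \<Phi>} = {\<lambda>q. g * q, \<lambda>q. - g * q}"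
proof (intro equalityI subsetI)
  fix \<Phi> assume "\<Phi> \<in> {\<Phi>. spin_coordinate_system n e1 e2 \<Phi>}"
  then obtain h where h: "norm h = 1" "h * q\<i> = im_quat e1 * h" "h * q\<j> = im_quat e2 * h"
    and \<Phi>: "\<Phi> = (\<lambda>q. h * q)"
    by (auto simp: spin_coordinate_system_iff)
  have g0: "g \<noteq> 0" using assms(1) by auto
  define c where "c = inverse g * h"
  have hc: "h = g * c" using g0 by (simp add: c_def flip: mult.assoc)
  have "g * (c * q\<i>) = g * (q\<i> * c)" "g * (c * q\<j>) = g * (q\<j> * c)"
    using h(2,3) assms(2,3) by (simp_all add: hc flip: mult.assoc)
  then have c: "c = quat_re c *\<^sub>R 1" using g0 by (intro commute_i_j_real) simp_all
  have "norm c = 1" using h(1) assms(1) by (simp add: hc norm_mult)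
  then have "\<bar>quat_re c\<bar> = 1" using c by (metis norm_scaleR norm_one mult.right_neutral)
  then have "quat_re c = 1 \<or> quat_re c = - 1" by linarith
  then have "c = 1 \<or> c = - 1" using c by (metis scaleR_minus1_left scaleR_one)
  then have "h = g \<or> h = - g" by (auto simp: hc)
  then show "\<Phi> \<in> {\<lambda>q. g * q, \<lambda>q. - g * q}" by (auto simp: \<Phi>)
next
  fix \<Phi> assume "\<Phi> \<in> {\<lambda>q. g * q, \<lambda>q. - g * q}"
  then obtain h where "\<Phi> = (\<lambda>q. h * q)" "h = g \<or> h = - g" by blast
  then have "spin_coordinate_system n e1 e2 \<Phi>"
    using assms by (auto simp: spin_coordinate_system_iff intro!: exI[of _ h])
  then show "\<Phi> \<in> {\<Phi>. spin_coordinate_system n e1 e2 \<Phi>}" by simp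
qed

theorem mainTheorem8:
  fixes \<Sigma> :: "(real^3) set"
    and \<O> :: "real^3 \<Rightarrow> ((real^3) \<times> (real^3)) set"
    and \<nu> :: "real^3 \<Rightarrow> real^3"
  assumes "oriented_surface \<Sigma> \<O>"
    and "oriented_unit_normal \<Sigma> \<O> \<nu>"
  shows "(\<exists>\<rho> :: real^3 \<Rightarrow> (real^3) free_algebra set \<Rightarrow> quat \<Rightarrow> quat.
            (\<forall>x\<in>\<Sigma>. \<forall>v\<in>tangent_space \<Sigma> x.
               \<rho> x (tangent_clifford_class \<Sigma> x (fa_gen v)) = (\<lambda>q. im_quat v * q)) \<and>
            irreducible_clifford_bundle \<Sigma> \<rho> \<and>
            (\<forall>x\<in>\<Sigma>. \<forall>A\<in>clifford_algebra (tangent_space \<Sigma> x) (\<bullet>). \<forall>q p.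
               \<rho> x A (q * p) = \<rho> x A q * p) \<and>
            (\<forall>x\<in>\<Sigma>. \<exists>F :: (quat \<Rightarrow> quat) \<Rightarrow> quat \<Rightarrow> quat.
               (\<forall>a b. F (LR_op q\<k> a b) = LR_op (im_quat (\<nu> x)) a b) \<and>
               (\<forall>\<psi>. M2C_identification \<psi> \<longrightarrow> right_M2C_action (\<lambda>q M. F (\<psi> M) q)) \<and>
               (\<forall>A\<in>clifford_even (tangent_space \<Sigma> x) (\<bullet>). \<forall>T\<in>ref_commutant.
                  \<rho> x A \<circ> F T = F T \<circ> \<rho> x A)))
       \<and> (\<forall>x\<in>\<Sigma>. \<forall>e1 e2 (R :: real^3^3) g.
            oriented_orthonormal_frame \<Sigma> \<O> x e1 e2 \<and>
            rotation_matrix R \<and> R *v axis 1 1 = e1 \<and> R *v axis 2 1 = e2 \<and> R *v axis 3 1 = \<nu> x \<and>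
            norm g = 1 \<and> (\<forall>v. g * im_quat v * inverse g = im_quat (R *v v)) \<longrightarrow>
            spin_coordinate_system (\<nu> x) e1 e2 (\<lambda>q. g * q) \<and>
            (\<lambda>q. - g * q) \<noteq> (\<lambda>q. g * q) \<and>
            {\<Phi>. spin_coordinate_system (\<nu> x) e1 e2 \<Phi>} = {\<lambda>q. g * q, \<lambda>q. - g * q})"
proof (intro conjI ballI allI impI)
  let ?\<rho> = "\<lambda>(x::real^3) A q. clifford_lift im_quat A * q"
  have sq: "im_quat (\<nu> x) * im_quat (\<nu> x) = - 1" if "x \<in> \<Sigma>" for x
    using assms(2) that by (simp add: oriented_unit_normal_def im_quat_mult dot_square_norm quat_eq_iff)
  have anti: "im_quat v * im_quat (\<nu> x) = - (im_quat (\<nu> x) * im_quat v)"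
    if "x \<in> \<Sigma>" "v \<in> tangent_space \<Sigma> x" for x v
    using assms(2) that im_quat_anticommute[of v "\<nu> x"]
    by (simp add: oriented_unit_normal_def inner_commute eq_neg_iff_add_eq_0)
  have comm: "?\<rho> x A \<circ> transport_op (im_quat (\<nu> x)) T = transport_op (im_quat (\<nu> x)) T \<circ> ?\<rho> x A"
    if x: "x \<in> \<Sigma>" and A: "A \<in> clifford_even (tangent_space \<Sigma> x) (\<bullet>)" and T: "T \<in> ref_commutant" for x A T
  proof -
    obtain a b where ab: "T = LR_op q\<k> a b" using T unfolding ref_commutant_eq by blast
    have "clifford_lift im_quat A * im_quat (\<nu> x) = im_quat (\<nu> x) * clifford_lift im_quat A"
      by (rule clifford_lift_even_commute[OF clifford_map_im_quat A]) (rule anti[OF x])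
    then show ?thesis
      unfolding ab transport_op_LR_op
      by (simp add: fun_eq_iff LR_op_def distrib_left flip: mult.assoc)
  qed
  show "\<exists>\<rho> :: real^3 \<Rightarrow> (real^3) free_algebra set \<Rightarrow> quat \<Rightarrow> quat.
            (\<forall>x\<in>\<Sigma>. \<forall>v\<in>tangent_space \<Sigma> x.
               \<rho> x (tangent_clifford_class \<Sigma> x (fa_gen v)) = (\<lambda>q. im_quat v * q)) \<and>
            irreducible_clifford_bundle \<Sigma> \<rho> \<and>
            (\<forall>x\<in>\<Sigma>. \<forall>A\<in>clifford_algebra (tangent_space \<Sigma> x) (\<bullet>). \<forall>q p.
               \<rho> x A (q * p) = \<rho> x A q * p) \<and>
            (\<forall>x\<in>\<Sigma>. \<exists>F :: (quat \<Rightarrow> quat) \<Rightarrow> quat \<Rightarrow> quat.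
               (\<forall>a b. F (LR_op q\<k> a b) = LR_op (im_quat (\<nu> x)) a b) \<and>
               (\<forall>\<psi>. M2C_identification \<psi> \<longrightarrow> right_M2C_action (\<lambda>q M. F (\<psi> M) q)) \<and>
               (\<forall>A\<in>clifford_even (tangent_space \<Sigma> x) (\<bullet>). \<forall>T\<in>ref_commutant.
                  \<rho> x A \<circ> F T = F T \<circ> \<rho> x A))"
  proof (rule exI[of _ ?\<rho>], intro conjI ballI)
    fix x v assume "v \<in> tangent_space \<Sigma> x"
    then show "?\<rho> x (tangent_clifford_class \<Sigma> x (fa_gen v)) = (\<lambda>q. im_quat v * q)"
      by (simp add: clifford_lift_class[OF clifford_map_im_quat] free_algebra_on_gen)
  next
    show "irreducible_clifford_bundle \<Sigma> ?\<rho>"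
      by (rule irreducible_clifford_bundle_im_quat[OF assms(1)])
  next
    fix x assume x: "x \<in> \<Sigma>"
    show "\<exists>F. (\<forall>a b. F (LR_op q\<k> a b) = LR_op (im_quat (\<nu> x)) a b) \<and>
        (\<forall>\<psi>. M2C_identification \<psi> \<longrightarrow> right_M2C_action (\<lambda>q M. F (\<psi> M) q)) \<and>
        (\<forall>A\<in>clifford_even (tangent_space \<Sigma> x) (\<bullet>). \<forall>T\<in>ref_commutant. ?\<rho> x A \<circ> F T = F T \<circ> ?\<rho> x A)"
      by (rule exI[of _ "transport_op (im_quat (\<nu> x))"], intro conjI allI ballI impI)
        (rule transport_op_LR_op transport_op_right_action[OF sq[OF x]] comm[OF x]; assumption?)+
  qed (simp add: mult.assoc)
next
  fix x e1 e2 R g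
  assume H: "oriented_orthonormal_frame \<Sigma> \<O> x e1 e2 \<and>
            rotation_matrix R \<and> R *v axis 1 1 = e1 \<and> R *v axis 2 1 = e2 \<and> R *v axis 3 1 = \<nu> x \<and>
            norm g = 1 \<and> (\<forall>v. g * im_quat v * inverse g = im_quat (R *v v))"
  then have g0: "g \<noteq> 0" by auto
  have "g * im_quat v = im_quat (R *v v) * g" for v
    using H g0 by (metis mult.assoc left_inverse mult.right_neutral)
  then have "g * q\<i> = im_quat e1 * g" "g * q\<j> = im_quat e2 * g" "g * q\<k> = im_quat (\<nu> x) * g"
    using H by (metis im_quat_axis)+
  then show eq: "{\<Phi>. spin_coordinate_system (\<nu> x) e1 e2 \<Phi>} = {\<lambda>q. g * q, \<lambda>q. - g * q}"
    using H by (intro spin_coordinate_systems_eq) simp_all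
  then show "spin_coordinate_system (\<nu> x) e1 e2 (\<lambda>q. g * q)" by blast
  have "- g \<noteq> g" using g0 by (auto simp: quat_eq_iff)
  then show "(\<lambda>q. - g * q) \<noteq> (\<lambda>q. g * q)" by (metis mult.right_neutral)
qed

end
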